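(* Let $S$ be a finite set with $0 \in S$, let $X \subset S^{\mathbb{Z}}$ be a one-dimensional subshift of finite type, and let $c : X \to X$ be a cellular automaton. If $c$ is asymptotically $0$-nilpotent, then $c$ is $0$-nilpotent.
   Context: $S^{\mathbb{Z}}$ carries the product topology of the discrete topology on the finite set $S$. For $v \in \mathbb{Z}$ the shift $\sigma^v$ is defined by $\sigma^v(x)_u = x_{u+v}$. A subshift is a topologically closed subset of $S^{\mathbb{Z}}$ that is invariant under $\sigma^v$ for all $v \in \mathbb{Z}$; equivalently, it is the set of configurations containing no translate of any pattern from some set of forbidden finite patterns. It is a subshift of finite type (SFT) if the set of forbidden patterns can be taken to be finite. A cellular automaton on $X$ is a continuous map $c : X \to X$ that commutes with $\sigma^v$ for all $v \in \mathbb{Z}$. $c^n$ denotes the $n$-fold iterate of $c$. $c$ is $0$-nilpotent if there exists $m \in \mathbb{N}$ such that for all $n \geq m$, all $x \in X$ and all $v \in \mathbb{Z}$, $c^n(x)_v = 0$. $c$ is asymptotically $0$-nilpotent if for all $x \in X$ and all $v \in \mathbb{Z}$ there exists $m \in \mathbb{N}$ such that for all $n \geq m$, $c^n(x)_v = 0$. *)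

theory Defs
  imports "HOL-Analysis.Analysis"
begin

definition full_shift_topology :: "'a set \<Rightarrow> (int \<Rightarrow> 'a) topology" where
  "full_shift_topology S = product_topology (\<lambda>_. discrete_topology S) UNIV"

definition full_shift :: "'a set \<Rightarrow> (int \<Rightarrow> 'a) set" where
  "full_shift S = {x. \<forall>u. x u \<in> S}"

lemma topspace_full_shift_topology [simp]:
  "topspace (full_shift_topology S) = full_shift S"
  by (auto simp: full_shift_topology_def full_shift_def PiE_def Pi_def)

definition shift :: "int \<Rightarrow> (int \<Rightarrow> 'a) \<Rightarrow> (int \<Rightarrow> 'a)" where
  "shift v x = (\<lambda>u. x (u + v))"

definition subshift :: "'a set \<Rightarrow> (int \<Rightarrow> 'a) set \<Rightarrow> bool" where
  "subshift S X \<longleftrightarrow>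
     closedin (full_shift_topology S) X \<and> (\<forall>v. shift v ` X = X)"

(* A finite pattern over S is a partial function from the integers to S with finite domain. *)

definition finite_patterns :: "'a set \<Rightarrow> (int \<rightharpoonup> 'a) set" where
  "finite_patterns S = {p. finite (dom p) \<and> ran p \<subseteq> S}"

definition pattern_occurs :: "(int \<rightharpoonup> 'a) \<Rightarrow> (int \<Rightarrow> 'a) \<Rightarrow> bool" where
  "pattern_occurs p x \<longleftrightarrow> (\<exists>v. \<forall>u\<in>dom p. p u = Some (shift v x u))"

definition avoiding :: "'a set \<Rightarrow> (int \<rightharpoonup> 'a) set \<Rightarrow> (int \<Rightarrow> 'a) set" where
  "avoiding S F = {x \<in> full_shift S. \<forall>p\<in>F. \<not> pattern_occurs p x}"

definition subshift_of_finite_type :: "'a set \<Rightarrow> (int \<Rightarrow> 'a) set \<Rightarrow> bool" where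
  "subshift_of_finite_type S X \<longleftrightarrow>
     subshift S X \<and> (\<exists>F. finite F \<and> F \<subseteq> finite_patterns S \<and> X = avoiding S F)"

(* The map c is only relevant on X; continuous_map also forces c to map X into X. *)

definition cellular_automaton ::
    "'a set \<Rightarrow> (int \<Rightarrow> 'a) set \<Rightarrow> ((int \<Rightarrow> 'a) \<Rightarrow> (int \<Rightarrow> 'a)) \<Rightarrow> bool" where
  "cellular_automaton S X c \<longleftrightarrow>
     continuous_map (subtopology (full_shift_topology S) X)
                    (subtopology (full_shift_topology S) X) c \<and>
     (\<forall>v. \<forall>x\<in>X. c (shift v x) = shift v (c x))"

(* In the next two definitions z is the distinguished symbol 0 of the alphabet. *)

definition nilpotent ::
    "'a \<Rightarrow> (int \<Rightarrow> 'a) set \<Rightarrow> ((int \<Rightarrow> 'a) \<Rightarrow> (int \<Rightarrow> 'a)) \<Rightarrow> bool" where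
  "nilpotent z X c \<longleftrightarrow> (\<exists>m. \<forall>n\<ge>m. \<forall>x\<in>X. \<forall>v. (c ^^ n) x v = z)"

definition asymptotically_nilpotent ::
    "'a \<Rightarrow> (int \<Rightarrow> 'a) set \<Rightarrow> ((int \<Rightarrow> 'a) \<Rightarrow> (int \<Rightarrow> 'a)) \<Rightarrow> bool" where
  "asymptotically_nilpotent z X c \<longleftrightarrow>
     (\<forall>x\<in>X. \<forall>v. \<exists>m. \<forall>n\<ge>m. (c ^^ n) x v = z)"

end

theory Submission
  imports Defs
begin

text \<open>
  Write 0 for the distinguished symbol and call a point homoclinic if only finitely many of its
  cells are nonzero. Suppose that \<open>c\<close> is asymptotically nilpotent but not nilpotent. The
  contradiction is a single point whose cells near the origin are nonzero at infinitely many times;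
  it is a limit of points each of which alters the previous one only outside the light cone of the
  visits already recorded (\<open>no_recurrent_visits\<close>). The difficulty is to see that a further
  visit can always be arranged without interference from what is already there.

  If long blocks of zeros protected the cell in their middle forever, then compactness would turn the
  eventual appearance of such a block into a uniform bound, and \<open>c\<close> would be nilpotent.
  So for each length there is a point that is zero on a block of this length around the origin and
  whose origin is nonzero at a later time; call it a visitor. The point of finite type is
  that tails may be exchanged: by pigeonhole a visitor can be given periodic tails of bounded period.
  The finitely many periodic points of that period die within a common time, and after this time the
  visitor has become homoclinic (\<open>homoclinic_visitor\<close>).

  A homoclinic point could send gliders away to infinity, and these could meet and destroy a visitor
  coming from afar. So mortal visitors are needed, homoclinic points that become identically zero.
  If the limit construction applied to all homoclinic points, asymptotic nilpotency would fail.
  Hence it gets stuck, at a homoclinic point \<open>b\<close>: every homoclinic point that agrees with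
  \<open>b\<close> on a certain window is, from some time on, zero on an interval that information cannot
  jump over (\<open>blocker\<close>). Copies of \<open>b\<close> repeated periodically form a periodic point,
  which dies at a time not depending on the visitor. Replacing the tails of a homoclinic visitor by
  such trains confines all that remains alive to the finite region between the two innermost
  copies, where it dies by asymptotic nilpotency (\<open>mortal_visitor\<close>).

  Mortal points can be combined freely: if a mortal point dies by time \<open>D\<close> and a mortal
  visitor is zero on a block large enough not to touch it by then, the two put together evolve from
  time \<open>D\<close> on like the visitor alone, so the sum is mortal again and has a further
  visit. Now the limit construction never gets stuck.
\<close>

section \<open>Compactness, radius and windows\<close>

lemma full_shift_compact:
  assumes "finite S"
  shows "compact_space (full_shift_topology S)"
  using assms by (simp add: full_shift_topology_def compact_space_product_topology compact_space_discrete_topology)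

lemma cylinder_open:
  fixes k :: int
  assumes "x \<in> full_shift S"
  shows "openin (full_shift_topology S) {y \<in> full_shift S. \<forall>u. \<bar>u\<bar> \<le> k \<longrightarrow> y u = x u}"
proof -
  let ?U = "\<lambda>u. if \<bar>u\<bar> \<le> k then {x u} else S"
  have eq: "{y \<in> full_shift S. \<forall>u. \<bar>u\<bar> \<le> k \<longrightarrow> y u = x u} = Pi\<^sub>E UNIV ?U"
    using assms by (auto simp: full_shift_def PiE_def Pi_def split: if_splits)
  have "finite {u. ?U u \<noteq> S}"
  proof (rule finite_subset)
    show "{u. ?U u \<noteq> S} \<subseteq> {-k..k}" by (auto split: if_splits)
  qed simp
  then show ?thesis
    unfolding eq full_shift_topology_def
    using assms by (subst openin_PiE_gen) (auto simp: full_shift_def)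
qed

lemma open_contains_cylinder:
  assumes "openin (full_shift_topology S) V" "x \<in> V"
  shows "\<exists>k::int. \<forall>y\<in>full_shift S. (\<forall>u. \<bar>u\<bar> \<le> k \<longrightarrow> y u = x u) \<longrightarrow> y \<in> V"
proof -
  obtain U where fin: "finite {i. U i \<noteq> S}" and xU: "x \<in> Pi\<^sub>E UNIV U" and sub: "Pi\<^sub>E UNIV U \<subseteq> V"
    using assms unfolding full_shift_topology_def openin_product_topology_alt by auto
  define k where "k = Max (insert 0 (abs ` {i. U i \<noteq> S}))"
  have k: "\<bar>i\<bar> \<le> k" if "U i \<noteq> S" for i
    unfolding k_def using fin that by (intro Max_ge) auto
  have "y \<in> V" if "y \<in> full_shift S" "\<forall>u. \<bar>u\<bar> \<le> k \<longrightarrow> y u = x u" for y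
  proof -
    have "y u \<in> U u" for u
      using that k[of u] xU by (cases "U u = S") (auto simp: full_shift_def PiE_def Pi_def)
    then show ?thesis using sub by (auto simp: PiE_def)
  qed
  then show ?thesis by blast
qed

text \<open>
  This is the only form in which compactness is used: a radius \<open>k x\<close> that depends on the
  point may be replaced by finitely many radii.
\<close>

lemma finite_cylinder_cover:
  fixes k :: "(int \<Rightarrow> 'a) \<Rightarrow> int"
  assumes "finite S" "closedin (full_shift_topology S) X"
  shows "\<exists>F\<subseteq>X. finite F \<and> (\<forall>y\<in>X. \<exists>x\<in>F. \<forall>u. \<bar>u\<bar> \<le> k x \<longrightarrow> y u = x u)"
proof -
  have sub: "X \<subseteq> full_shift S"
    using closedin_subset[OF assms(2)] by simp
  have comp: "compactin (full_shift_topology S) X"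
    using closedin_compact_space full_shift_compact assms by blast
  define Cyl where "Cyl = (\<lambda>x. {y \<in> full_shift S. \<forall>u. \<bar>u\<bar> \<le> k x \<longrightarrow> y u = x u})"
  have "\<forall>U\<in>Cyl ` X. openin (full_shift_topology S) U"
    using cylinder_open sub unfolding Cyl_def by blast
  moreover have "X \<subseteq> \<Union>(Cyl ` X)"
    using sub by (auto simp: Cyl_def)
  ultimately obtain \<F> where "finite \<F>" "\<F> \<subseteq> Cyl ` X" "X \<subseteq> \<Union>\<F>"
    using comp unfolding compactin_def by meson
  then obtain F where "F \<subseteq> X" "finite F" "X \<subseteq> \<Union>(Cyl ` F)"
    by (metis finite_subset_image)
  moreover have "\<forall>y\<in>X. \<exists>x\<in>F. \<forall>u. \<bar>u\<bar> \<le> k x \<longrightarrow> y u = x u"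
    using \<open>X \<subseteq> \<Union>(Cyl ` F)\<close> unfolding Cyl_def by blast
  ultimately show ?thesis by blast
qed

text \<open>
  The Curtis-Hedlund-Lyndon theorem. Continuity makes the symbol at the origin of the image depend,
  near each point, on a finite window; compactness makes the window uniform, and shift
  invariance moves it to all cells.
\<close>

lemma cellular_automaton_has_radius:
  assumes fin: "finite S" and sub: "subshift S X" and ca: "cellular_automaton S X c"
  shows "\<exists>r\<ge>0. \<forall>x\<in>X. \<forall>y\<in>X. \<forall>i. (\<forall>u. \<bar>u - i\<bar> \<le> r \<longrightarrow> x u = y u) \<longrightarrow> c x i = c y i"
proof -
  have cl: "closedin (full_shift_topology S) X" and inv: "\<And>v. shift v ` X = X"
    using sub by (auto simp: subshift_def)
  have XS: "X \<subseteq> full_shift S" using closedin_subset[OF cl] by simp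
  have cont: "continuous_map (subtopology (full_shift_topology S) X)
                    (subtopology (full_shift_topology S) X) c"
    and comm: "\<And>v x. x \<in> X \<Longrightarrow> c (shift v x) = shift v (c x)"
    using ca by (auto simp: cellular_automaton_def)
  have cX: "c x \<in> X" if "x \<in> X" for x
    using continuous_map_funspace[OF cont] that XS by auto
  have "\<exists>k::int. \<forall>y\<in>X. (\<forall>u. \<bar>u\<bar> \<le> k \<longrightarrow> y u = x u) \<longrightarrow> c y 0 = c x 0" if x: "x \<in> X" for x
  proof -
    let ?W = "{w \<in> full_shift S. \<forall>u. \<bar>u\<bar> \<le> 0 \<longrightarrow> w u = c x u}"
    have "openin (full_shift_topology S) ?W"
      using cylinder_open cX[OF x] XS by blast
    then have "openin (subtopology (full_shift_topology S) X) (?W \<inter> X)"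
      by (rule openin_subtopology_Int)
    then have "openin (subtopology (full_shift_topology S) X)
        {y \<in> topspace (subtopology (full_shift_topology S) X). c y \<in> ?W \<inter> X}"
      using cont openin_continuous_map_preimage by blast
    then obtain V where V: "openin (full_shift_topology S) V"
      "{y \<in> full_shift S \<inter> X. c y \<in> ?W \<inter> X} = V \<inter> X"
      by (auto simp: openin_subtopology)
    have "x \<in> V \<inter> X"
      unfolding V(2)[symmetric] using x cX[OF x] XS by auto
    then obtain k :: int where "\<forall>y\<in>full_shift S. (\<forall>u. \<bar>u\<bar> \<le> k \<longrightarrow> y u = x u) \<longrightarrow> y \<in> V"
      using open_contains_cylinder[OF V(1)] by blast
    then have "\<forall>y\<in>X. (\<forall>u. \<bar>u\<bar> \<le> k \<longrightarrow> y u = x u) \<longrightarrow> c y \<in> ?W"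
      using V(2) XS by blast
    then show ?thesis by fastforce
  qed
  then obtain k :: "(int \<Rightarrow> 'a) \<Rightarrow> int" where
    k: "\<And>x y. x \<in> X \<Longrightarrow> y \<in> X \<Longrightarrow> (\<forall>u. \<bar>u\<bar> \<le> k x \<longrightarrow> y u = x u) \<Longrightarrow> c y 0 = c x 0"
    by metis
  obtain F where F: "F \<subseteq> X" "finite F" "\<forall>y\<in>X. \<exists>x\<in>F. \<forall>u. \<bar>u\<bar> \<le> k x \<longrightarrow> y u = x u"
    using finite_cylinder_cover[OF fin cl] by metis
  define r where "r = Max (insert 0 (k ` F))"
  have r: "r \<ge> 0" "\<And>x. x \<in> F \<Longrightarrow> k x \<le> r"
    using F(2) by (auto simp: r_def)
  have at0: "c x 0 = c y 0" if xy: "x \<in> X" "y \<in> X" "\<forall>u. \<bar>u\<bar> \<le> r \<longrightarrow> x u = y u" for x y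
  proof -
    obtain w where w: "w \<in> F" "\<forall>u. \<bar>u\<bar> \<le> k w \<longrightarrow> x u = w u"
      using F(3) xy(1) by blast
    have "y u = w u" if "\<bar>u\<bar> \<le> k w" for u
    proof -
      have "\<bar>u\<bar> \<le> r" using that r(2)[OF w(1)] by linarith
      then show ?thesis using w(2) xy(3) that by metis
    qed
    moreover have "w \<in> X" using F(1) w(1) by blast
    ultimately show ?thesis using k w(2) xy(1,2) by metis
  qed
  have "c x i = c y i" if "x \<in> X" "y \<in> X" "\<forall>u. \<bar>u - i\<bar> \<le> r \<longrightarrow> x u = y u" for x y i
  proof -
    have "c (shift i x) 0 = c (shift i y) 0"
      by (rule at0) (use that inv in \<open>auto simp: shift_def\<close>)
    then show ?thesis using comm that by (simp add: shift_def)
  qed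
  then show ?thesis using r(1) by blast
qed

text \<open>
  For a subshift of finite type, membership can be tested on windows of one fixed length, each
  being compared with a point of the subshift chosen for that window alone. All constructions of points below rest on this.
\<close>

lemma finite_type_has_window:
  assumes "subshift_of_finite_type S X"
  shows "\<exists>m>0. \<forall>x. (\<forall>v. \<exists>y\<in>X. \<forall>u\<in>{v..<v + m}. x u = y u) \<longrightarrow> x \<in> X"
proof -
  obtain F where F: "finite F" "F \<subseteq> finite_patterns S" "X = avoiding S F"
    using assms by (auto simp: subshift_of_finite_type_def)
  have fin: "finite (\<Union>p\<in>F. dom p)"
    using F by (auto simp: finite_patterns_def)
  define k where "k = Max (insert 0 (abs ` (\<Union>p\<in>F. dom p)))"
  have k0: "k \<ge> 0" and k: "\<And>p u. p \<in> F \<Longrightarrow> u \<in> dom p \<Longrightarrow> \<bar>u\<bar> \<le> k"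
    unfolding k_def using fin by (auto intro!: Max_ge)
  have "x \<in> X" if loc: "\<forall>v. \<exists>y\<in>X. \<forall>u\<in>{v..<v + (2 * k + 1)}. x u = y u" for x
  proof -
    have "x u \<in> S" for u
    proof -
      obtain y where "y \<in> X" "\<forall>w\<in>{u..<u + (2 * k + 1)}. x w = y w" using loc by blast
      then show ?thesis using k0 F(3) by (auto simp: avoiding_def full_shift_def)
    qed
    moreover have "\<not> pattern_occurs p x" if p: "p \<in> F" for p
    proof
      assume "pattern_occurs p x"
      then obtain v where v: "\<forall>u\<in>dom p. p u = Some (x (u + v))"
        by (auto simp: pattern_occurs_def shift_def)
      obtain y where y: "y \<in> X" "\<forall>u\<in>{v - k..<v - k + (2 * k + 1)}. x u = y u"
        using loc by blast
      have "p u = Some (shift v y u)" if u: "u \<in> dom p" for u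
      proof -
        have "u + v \<in> {v - k..<v - k + (2 * k + 1)}"
          using k[OF p u] by (auto simp: abs_le_iff)
        with y(2) v u show ?thesis by (auto simp: shift_def)
      qed
      then have "pattern_occurs p y" unfolding pattern_occurs_def by blast
      then show False using y(1) F(3) p by (auto simp: avoiding_def)
    qed
    ultimately show ?thesis using F(3) by (auto simp: avoiding_def full_shift_def)
  qed
  then show ?thesis using k0 by (intro exI[of _ "2 * k + 1"]) auto
qed

section \<open>Light cones and the zero point\<close>

text \<open>
  The consequences of the topological hypotheses that the argument needs: a window length
  \<open>m\<close>, a radius \<open>r\<close>, and finite covers by cylinders.
\<close>

locale asymptotically_nilpotent_automaton =
  fixes S :: "'a set" and z :: 'a
    and X :: "(int \<Rightarrow> 'a) set" and c :: "(int \<Rightarrow> 'a) \<Rightarrow> (int \<Rightarrow> 'a)"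
    and m r :: int
  assumes finite_symbols: "finite S"
    and symbols: "x \<in> X \<Longrightarrow> x u \<in> S"
    and shift_mem: "x \<in> X \<Longrightarrow> shift v x \<in> X"
    and cover: "\<exists>F\<subseteq>X. finite F \<and> (\<forall>y\<in>X. \<exists>x\<in>F. \<forall>u. \<bar>u\<bar> \<le> (k :: (int \<Rightarrow> 'a) \<Rightarrow> int) x \<longrightarrow> y u = x u)"
    and m_pos: "m > 0"
    and memI: "(\<And>v. \<exists>y\<in>X. \<forall>u\<in>{v..<v + m}. x u = y u) \<Longrightarrow> x \<in> X"
    and c_mem: "x \<in> X \<Longrightarrow> c x \<in> X"
    and c_shift: "x \<in> X \<Longrightarrow> c (shift v x) = shift v (c x)"
    and r_nonneg: "r \<ge> 0"
    and radius: "x \<in> X \<Longrightarrow> y \<in> X \<Longrightarrow> (\<And>u. \<bar>u - i\<bar> \<le> r \<Longrightarrow> x u = y u) \<Longrightarrow> c x i = c y i"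
    and vanishing: "x \<in> X \<Longrightarrow> \<exists>N. \<forall>n\<ge>N. (c ^^ n) x u = z"
    and nonempty: "X \<noteq> {}"
begin

abbreviation blank :: "int \<Rightarrow> 'a" where
  "blank \<equiv> (\<lambda>_. z)"

lemma iter_mem: "x \<in> X \<Longrightarrow> (c ^^ n) x \<in> X"
  by (induction n) (auto intro: c_mem)

lemma iter_shift: "x \<in> X \<Longrightarrow> (c ^^ n) (shift v x) = shift v ((c ^^ n) x)"
  by (induction n) (auto simp: c_shift iter_mem)

lemma iter_add: "(c ^^ (n + k)) x = (c ^^ n) ((c ^^ k) x)"
  by (simp add: funpow_add)

lemma light_cone:
  assumes "x \<in> X" "y \<in> X" "\<And>u. \<bar>u - i\<bar> \<le> r * int n \<Longrightarrow> x u = y u"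
  shows "(c ^^ n) x i = (c ^^ n) y i"
  using assms(3)
proof (induction n arbitrary: i)
  case 0
  then show ?case by simp
next
  case (Suc n)
  have "c ((c ^^ n) x) i = c ((c ^^ n) y) i"
  proof (rule radius)
    fix u assume u: "\<bar>u - i\<bar> \<le> r"
    show "(c ^^ n) x u = (c ^^ n) y u"
    proof (rule Suc.IH)
      fix v assume "\<bar>v - u\<bar> \<le> r * int n"
      then show "x v = y v" using u by (intro Suc.prems) (simp add: distrib_left)
    qed
  qed (use assms iter_mem in auto)
  then show ?case by simp
qed

lemma vanishing_on_finite:
  assumes "x \<in> X" "finite I"
  shows "\<exists>N. \<forall>n\<ge>N. \<forall>u\<in>I. (c ^^ n) x u = z"
  using assms(2)
proof induction
  case (insert i I)
  then obtain N where "\<forall>n\<ge>N. \<forall>u\<in>I. (c ^^ n) x u = z" by blast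
  moreover obtain N' where "\<forall>n\<ge>N'. (c ^^ n) x i = z" using vanishing assms(1) by blast
  ultimately show ?case by (intro exI[of _ "max N N'"]) auto
qed simp

lemma vanishing_on_ball:
  assumes "x \<in> X"
  shows "\<exists>N. \<forall>n\<ge>N. \<forall>u. \<bar>u\<bar> \<le> K \<longrightarrow> (c ^^ n) x u = z"
proof -
  obtain N where "\<forall>n\<ge>N. \<forall>u\<in>{- K..K}. (c ^^ n) x u = z"
    using vanishing_on_finite[OF assms] by blast
  moreover have "u \<in> {- K..K}" if "\<bar>u\<bar> \<le> K" for u
    using that by (auto simp: abs_le_iff)
  ultimately show ?thesis by blast
qed

text \<open>
  On each window, the zero point looks like a late iterate of any other point. This also gives
  that it is fixed by \<open>c\<close>: the iterate stays zero on the window for one more step.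
\<close>

lemma blank_mem: "blank \<in> X"
proof (rule memI)
  fix v :: int
  obtain x where x: "x \<in> X" using nonempty by blast
  then obtain N where "\<forall>n\<ge>N. \<forall>u\<in>{v..<v + m}. (c ^^ n) x u = z"
    using vanishing_on_finite by blast
  then show "\<exists>y\<in>X. \<forall>u\<in>{v..<v + m}. z = y u"
    using iter_mem[OF x] by (intro bexI[of _ "(c ^^ N) x"]) auto
qed

lemma c_blank: "c blank = blank"
proof
  fix i
  obtain x where x: "x \<in> X" using nonempty by blast
  then obtain N where N: "\<forall>n\<ge>N. \<forall>u\<in>{i - r..i + r}. (c ^^ n) x u = z"
    using vanishing_on_finite by blast
  have "c blank i = c ((c ^^ N) x) i"
    by (rule radius) (use N in \<open>auto simp: blank_mem iter_mem x abs_le_iff\<close>)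
  also have "\<dots> = (c ^^ Suc N) x i" by simp
  also have "\<dots> = z" using N[rule_format, of "Suc N" i] r_nonneg by simp
  finally show "c blank i = z" .
qed

lemma iter_blank: "(c ^^ n) blank = blank"
  by (induction n) (auto simp: c_blank)

lemma light_cone_blank:
  assumes "x \<in> X" "\<And>u. \<bar>u - i\<bar> \<le> r * int n \<Longrightarrow> x u = z"
  shows "(c ^^ n) x i = z"
  using light_cone[OF assms(1) blank_mem, of i n] assms(2) by (simp add: iter_blank)

lemma arrival_time:
  assumes "x \<in> X" "\<And>u. \<bar>u\<bar> \<le> K \<Longrightarrow> x u = z" "(c ^^ t) x 0 \<noteq> z"
  shows "r * int t > K"
proof (rule ccontr)
  assume "\<not> ?thesis"
  then have "(c ^^ t) x 0 = z" using assms(2) by (intro light_cone_blank assms(1)) auto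
  with assms(3) show False by simp
qed

section \<open>Exchanging tails\<close>

lemma glue:
  assumes "x \<in> X" "y \<in> X" "\<And>u. a \<le> u \<Longrightarrow> u < a + m \<Longrightarrow> x u = y u"
  shows "(\<lambda>u. if u < a then x u else y u) \<in> X"
proof (rule memI)
  fix v
  show "\<exists>w\<in>X. \<forall>u\<in>{v..<v + m}. (if u < a then x u else y u) = w u"
    using assms by (cases "v < a") (force, force)
qed

lemma insert_block:
  assumes "x \<in> X" "y \<in> X" "a \<ge> 0"
    and "\<And>u. a \<le> u \<Longrightarrow> u < a + m \<Longrightarrow> x u = y u"
    and "\<And>u. - a - m \<le> u \<Longrightarrow> u < - a \<Longrightarrow> x u = y u"
  shows "(\<lambda>u. if - a \<le> u \<and> u < a then x u else y u) \<in> X"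
proof -
  let ?g = "\<lambda>u. if u < a then x u else y u"
  have "?g \<in> X" by (rule glue) (use assms in auto)
  then have "(\<lambda>u. if u < - a - m then y u else ?g u) \<in> X"
    using assms by (intro glue) auto
  moreover have "(\<lambda>u. if u < - a - m then y u else ?g u) = (\<lambda>u. if - a \<le> u \<and> u < a then x u else y u)"
    using assms m_pos by (fastforce simp: fun_eq_iff)
  ultimately show ?thesis by simp
qed

section \<open>Homoclinic visitors\<close>

definition periodic_points :: "int \<Rightarrow> (int \<Rightarrow> 'a) set" where
  "periodic_points P = {p \<in> X. \<exists>q\<in>{1..P}. \<forall>u. p (u + q) = p u}"

lemma periodic_mod:
  fixes q :: int
  assumes "\<forall>u. p (u + q) = p u"
  shows "p (u mod q) = p u"
proof -
  have nat: "p (v + int n * q) = p v" for v n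
  proof (induction n)
    case (Suc n)
    have "p (v + int (Suc n) * q) = p (v + int n * q + q)" by (simp add: algebra_simps)
    with Suc assms show ?case by simp
  qed simp
  have "p (v + k * q) = p v" for v k
  proof (cases "k \<ge> 0")
    case True
    then show ?thesis using nat[of v "nat k"] by simp
  next
    case False
    then show ?thesis using nat[of "v + k * q" "nat (- k)"] by simp
  qed
  from this[of "u mod q" "u div q"] show ?thesis by simp
qed

lemma finite_periodic_points: "finite (periodic_points P)"
proof -
  have "periodic_points P \<subseteq> (\<Union>q\<in>{1..P}. (\<lambda>f u. f (u mod q)) ` (PiE {0..<q} (\<lambda>_. S)))"
  proof
    fix p assume "p \<in> periodic_points P"
    then obtain q where q: "p \<in> X" "q \<in> {1..P}" "\<forall>u. p (u + q) = p u"
      by (auto simp: periodic_points_def)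
    have "p = (\<lambda>u. restrict p {0..<q} (u mod q))"
      using q periodic_mod[OF q(3)] by (auto simp: fun_eq_iff)
    moreover have "restrict p {0..<q} \<in> PiE {0..<q} (\<lambda>_. S)"
      using symbols[OF q(1)] by auto
    ultimately show "p \<in> (\<Union>q\<in>{1..P}. (\<lambda>f u. f (u mod q)) ` (PiE {0..<q} (\<lambda>_. S)))"
      using q(2) by blast
  qed
  moreover have "finite (\<Union>q\<in>{1..P}. (\<lambda>f u. f (u mod q)) ` (PiE {0..<q} (\<lambda>_. S)))"
    using finite_symbols by (auto intro!: finite_PiE)
  ultimately show ?thesis by (rule finite_subset)
qed

lemma iter_periodic:
  assumes "p \<in> X" "\<forall>u. p (u + q) = p u"
  shows "(c ^^ n) p (u + q) = (c ^^ n) p u"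
proof -
  have "shift q p = p" using assms(2) by (auto simp: shift_def)
  then have "shift q ((c ^^ n) p) = (c ^^ n) p" using iter_shift[OF assms(1)] by metis
  then show ?thesis by (metis shift_def)
qed

text \<open>
  All iterates keep the period, so vanishing on one period is vanishing everywhere.
\<close>

lemma periodic_dies:
  assumes "p \<in> periodic_points P"
  shows "\<exists>N. \<forall>n\<ge>N. (c ^^ n) p = blank"
proof -
  obtain q where q: "p \<in> X" "q \<in> {1..P}" "\<forall>u. p (u + q) = p u"
    using assms by (auto simp: periodic_points_def)
  obtain N where N: "\<forall>n\<ge>N. \<forall>u\<in>{0..<q}. (c ^^ n) p u = z"
    using vanishing_on_finite q(1) by blast
  have "(c ^^ n) p u = z" if "n \<ge> N" for n u
  proof -
    have "(c ^^ n) p u = (c ^^ n) p (u mod q)"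
      using periodic_mod[of "(c ^^ n) p" q u] iter_periodic[OF q(1,3)] by simp
    also have "\<dots> = z" using N that q(2) by auto
    finally show ?thesis .
  qed
  then show ?thesis by blast
qed

lemma periodic_points_die_together:
  "\<exists>N. \<forall>p\<in>periodic_points P. \<forall>n\<ge>N. (c ^^ n) p = blank"
proof -
  obtain N where N: "\<And>p n. p \<in> periodic_points P \<Longrightarrow> n \<ge> N p \<Longrightarrow> (c ^^ n) p = blank"
    using periodic_dies by metis
  show ?thesis
  proof (intro exI ballI allI impI)
    fix p n assume p: "p \<in> periodic_points P" "n \<ge> Max (N ` periodic_points P)"
    then have "N p \<le> n" using finite_periodic_points by (meson Max_ge finite_imageI imageI order_trans)
    with p N show "(c ^^ n) p = blank" by blast
  qed
qed

text \<open>
  If the same word of length \<open>m\<close> occurs at \<open>i\<close> and at \<open>j\<close>, then the stretch between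
  may be repeated forever: each window of the repetition already occurs in \<open>x\<close>, starting at
  some cell between \<open>i\<close> and \<open>j\<close>.
\<close>

lemma periodize:
  assumes x: "x \<in> X" and ij: "i < j"
    and rep: "\<And>u. i \<le> u \<Longrightarrow> u < i + m \<Longrightarrow> x (u + (j - i)) = x u"
  defines "p \<equiv> (\<lambda>u. x (i + (u - i) mod (j - i)))"
  shows "p \<in> periodic_points (j - i)" and "\<And>u. i \<le> u \<Longrightarrow> u < j + m \<Longrightarrow> p u = x u"
proof -
  define q where "q = j - i"
  have q: "q > 0" using ij by (simp add: q_def)
  have per: "p (u + q) = p u" for u
  proof -
    have "(u + q - i) mod q = (u - i + q) mod q" by (simp add: algebra_simps)
    also have "\<dots> = (u - i) mod q" by simp
    finally show ?thesis by (simp add: p_def q_def)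
  qed
  have agree: "p (i + int n) = x (i + int n)" if "i + int n < j + m" for n
    using that
  proof (induction n rule: less_induct)
    case (less n)
    show ?case
    proof (cases "int n < q")
      case True
      then show ?thesis by (simp add: p_def q_def[symmetric])
    next
      case False
      define k where "k = nat (int n - q)"
      have k: "int n = int k + q" using False by (simp add: k_def)
      have "p (i + int n) = p (i + int k)" using per[of "i + int k"] by (simp add: k algebra_simps)
      also have "\<dots> = x (i + int k)"
        using less.prems k q by (intro less.IH) auto
      also have "\<dots> = x (i + int k + q)"
        unfolding q_def by (rule rep[symmetric]) (use less.prems k in \<open>auto simp: q_def\<close>)
      also have "\<dots> = x (i + int n)" by (simp add: k algebra_simps)
      finally show ?thesis .
    qed
  qed
  show ag: "p u = x u" if "i \<le> u" "u < j + m" for u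
    using agree[of "nat (u - i)"] that by simp
  have "p \<in> X"
  proof (rule memI)
    fix v
    define w where "w = i + (v - i) mod q"
    have w: "i \<le> w" "w < j" using q by (auto simp: w_def q_def pos_mod_bound algebra_simps)
      (smt (verit) pos_mod_bound q q_def)
    have "p u = shift (w - v) x u" if u: "u \<in> {v..<v + m}" for u
    proof -
      have "p u = p (u + (w - v))"
      proof -
        have "w - v = - ((v - i) div q) * q"
          unfolding w_def by (simp add: algebra_simps minus_div_mult_eq_mod[symmetric])
        then have "u + (w - v) - i = u - i + (- ((v - i) div q)) * q"
          by linarith
        then have "(u + (w - v) - i) mod q = (u - i + (- ((v - i) div q)) * q) mod q"
          by (rule arg_cong)
        also have "\<dots> = (u - i) mod q" by (rule mod_mult_self1)
        finally show ?thesis by (simp add: p_def q_def)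
      qed
      also have "\<dots> = x (u + (w - v))" by (rule ag) (use u w in auto)
      finally show ?thesis by (simp add: shift_def)
    qed
    then show "\<exists>y\<in>X. \<forall>u\<in>{v..<v + m}. p u = y u" using shift_mem[OF x] by blast
  qed
  then show "p \<in> periodic_points (j - i)"
    using per q by (auto simp: periodic_points_def q_def[symmetric] intro!: bexI[of _ q])
qed

definition words :: nat where
  "words = card (PiE {0..<m} (\<lambda>_. S))"

lemma repeated_window:
  assumes x: "x \<in> X"
  shows "\<exists>i j. a \<le> i \<and> i < j \<and> j \<le> a + int words \<and>
    (\<forall>u. i \<le> u \<longrightarrow> u < i + m \<longrightarrow> x (u + (j - i)) = x u)"
proof -
  define f where "f = (\<lambda>i. restrict (\<lambda>u. x (i + u)) {0..<m})"
  have fin: "finite (PiE {0..<m} (\<lambda>_. S))" using finite_symbols by (intro finite_PiE) auto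
  have sub: "f ` {a..a + int words} \<subseteq> PiE {0..<m} (\<lambda>_. S)"
    using symbols[OF x] by (auto simp: f_def)
  have "card (f ` {a..a + int words}) \<le> words"
    unfolding words_def by (rule card_mono[OF fin]) (use sub in \<open>simp add: words_def\<close>)
  then have "\<not> inj_on f {a..a + int words}"
    by (intro pigeonhole) simp
  then obtain i j where ij: "i \<in> {a..a + int words}" "j \<in> {a..a + int words}" "f i = f j" "i < j"
    by (metis inj_on_def linorder_neqE_linordered_idom)
  have "x (u + (j - i)) = x u" if "i \<le> u" "u < i + m" for u
    using fun_cong[OF ij(3), of "u - i"] that by (simp add: f_def algebra_simps)
  with ij show ?thesis by (intro exI[of _ i] exI[of _ j]) auto
qed

definition homoclinic :: "(int \<Rightarrow> 'a) set" where
  "homoclinic = {x \<in> X. \<exists>B. \<forall>u. \<bar>u\<bar> > B \<longrightarrow> x u = z}"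

text \<open>
  The time \<open>N\<close> does not depend on the point or on the size of the part that is kept, because
  the pigeonhole principle bounds the periods of the new tails by the number of words of length \<open>m\<close>.
  This uniformity matters: running a visitor for \<open>N\<close> steps shortens its central block of
  zeros by a known amount.
\<close>

lemma periodic_tails:
  "\<exists>N. \<forall>x\<in>X. \<forall>M. \<exists>y\<in>X. (\<forall>u. \<bar>u\<bar> \<le> M \<longrightarrow> y u = x u) \<and> (c ^^ N) y \<in> homoclinic"
proof -
  obtain N where N: "\<And>p n. p \<in> periodic_points (int words) \<Longrightarrow> n \<ge> N \<Longrightarrow> (c ^^ n) p = blank"
    using periodic_points_die_together by meson
  have mono: "p \<in> periodic_points (int words)" if "p \<in> periodic_points d" "d \<le> int words" for p d
    using that by (auto simp: periodic_points_def)
  have "\<exists>y\<in>X. (\<forall>u. \<bar>u\<bar> \<le> M \<longrightarrow> y u = x u) \<and> (c ^^ N) y \<in> homoclinic" if x: "x \<in> X" for x M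
  proof -
    obtain i j where right: "\<bar>M\<bar> < i" "i < j" "j - i \<le> int words"
        "\<And>u. i \<le> u \<Longrightarrow> u < i + m \<Longrightarrow> x (u + (j - i)) = x u"
      using repeated_window[OF x, of "\<bar>M\<bar> + 1"] by force
    obtain i' j' where left: "j' + m < - \<bar>M\<bar>" "i' < j'" "j' - i' \<le> int words"
        "\<And>u. i' \<le> u \<Longrightarrow> u < i' + m \<Longrightarrow> x (u + (j' - i')) = x u"
      using repeated_window[OF x, of "- \<bar>M\<bar> - m - int words - 1"] by force
    define p where "p = (\<lambda>u. x (i + (u - i) mod (j - i)))"
    define p' where "p' = (\<lambda>u. x (i' + (u - i') mod (j' - i')))"
    have p: "p \<in> periodic_points (j - i)" "\<And>u. i \<le> u \<Longrightarrow> u < j + m \<Longrightarrow> p u = x u"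
      using periodize[OF x right(2,4)] by (auto simp: p_def)
    have p': "p' \<in> periodic_points (j' - i')" "\<And>u. i' \<le> u \<Longrightarrow> u < j' + m \<Longrightarrow> p' u = x u"
      using periodize[OF x left(2,4)] by (auto simp: p'_def)
    have pX: "p \<in> X" "p' \<in> X" using p(1) p'(1) by (auto simp: periodic_points_def)
    define g where "g = (\<lambda>u. if u < i then x u else p u)"
    define y where "y = (\<lambda>u. if u < i' then p' u else g u)"
    have gX: "g \<in> X" unfolding g_def by (rule glue) (use x pX p(2) right in auto)
    have "y \<in> X" unfolding y_def
    proof (rule glue)
      fix u assume "i' \<le> u" "u < i' + m"
      then show "p' u = g u" using p'(2) left right by (auto simp: g_def)
    qed (use pX gX in auto)
    moreover have "y u = x u" if "\<bar>u\<bar> \<le> M" for u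
      using that right left m_pos by (auto simp: y_def g_def)
    moreover have "(c ^^ N) y u = z" if u: "\<bar>u\<bar> > \<bar>i\<bar> + \<bar>i'\<bar> + r * int N" for u
    proof (cases "u > 0")
      case True
      have "(c ^^ N) y u = (c ^^ N) p u"
        by (rule light_cone[OF \<open>y \<in> X\<close> pX(1)]) (use True u left right m_pos in \<open>auto simp: y_def g_def\<close>)
      also have "\<dots> = z" using N mono p(1) right(3) by auto
      finally show ?thesis .
    next
      case False
      have "(c ^^ N) y u = (c ^^ N) p' u"
        by (rule light_cone[OF \<open>y \<in> X\<close> pX(2)]) (use False u in \<open>auto simp: y_def\<close>)
      also have "\<dots> = z" using N mono p'(1) left(3) by auto
      finally show ?thesis .
    qed
    ultimately show ?thesis
      using iter_mem by (intro bexI[of _ y]) (auto simp: homoclinic_def)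
  qed
  then show ?thesis by blast
qed

text \<open>
  Every point acquires a block of zeros on \<open>[-K, K]\<close> at some time, which is seen on a finite
  window. Compactness bounds this time, and from then on the block protects the origin.
\<close>

lemma nilpotent_if_blank_protected:
  assumes "\<And>x t. x \<in> X \<Longrightarrow> (\<And>u. \<bar>u\<bar> \<le> K \<Longrightarrow> x u = z) \<Longrightarrow> (c ^^ t) x 0 = z"
  shows "nilpotent z X c"
proof -
  have "\<exists>n. \<forall>u. \<bar>u\<bar> \<le> K \<longrightarrow> (c ^^ n) x u = z" if "x \<in> X" for x
    using vanishing_on_ball[OF that] by blast
  then obtain n where n: "\<And>x u. x \<in> X \<Longrightarrow> \<bar>u\<bar> \<le> K \<Longrightarrow> (c ^^ n x) x u = z"
    by metis
  obtain F where F: "F \<subseteq> X" "finite F"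
      "\<forall>y\<in>X. \<exists>x\<in>F. \<forall>u. \<bar>u\<bar> \<le> K + r * int (n x) \<longrightarrow> y u = x u"
    using cover[of "\<lambda>x. K + r * int (n x)"] by blast
  have dies: "(c ^^ t) y 0 = z" if y: "y \<in> X" and t: "t \<ge> Max (n ` F)" for y t
  proof -
    obtain x where x: "x \<in> F" "\<forall>u. \<bar>u\<bar> \<le> K + r * int (n x) \<longrightarrow> y u = x u"
      using F(3) y by blast
    have le: "n x \<le> t" using t x(1) F(2) by (meson Max_ge finite_imageI imageI order_trans)
    have "(c ^^ n x) y u = z" if "\<bar>u\<bar> \<le> K" for u
    proof -
      have "(c ^^ n x) y u = (c ^^ n x) x u"
        by (rule light_cone) (use y x F(1) that in auto)
      also have "\<dots> = z" using n x(1) F(1) that by blast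
      finally show ?thesis .
    qed
    then have "(c ^^ (t - n x)) ((c ^^ n x) y) 0 = z"
      using assms iter_mem[OF y] by blast
    then show ?thesis using le by (simp flip: iter_add)
  qed
  have "(c ^^ t) x v = z" if "x \<in> X" "t \<ge> Max (n ` F)" for x t v
    using dies[OF shift_mem[OF that(1)] that(2), of v] iter_shift[OF that(1)]
    by (simp add: shift_def)
  then show ?thesis unfolding nilpotent_def by blast
qed

lemma homoclinic_visitor:
  assumes "\<not> nilpotent z X c"
  shows "\<exists>x\<in>homoclinic. (\<forall>u. \<bar>u\<bar> \<le> K \<longrightarrow> x u = z) \<and> (\<exists>t. (c ^^ t) x 0 \<noteq> z)"
proof -
  obtain N where N: "\<And>x M. x \<in> X \<Longrightarrow> \<exists>y\<in>X. (\<forall>u. \<bar>u\<bar> \<le> M \<longrightarrow> y u = x u) \<and> (c ^^ N) y \<in> homoclinic"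
    using periodic_tails by blast
  define K' where "K' = \<bar>K\<bar> + r * int N"
  obtain x t where x: "x \<in> X" "\<And>u. \<bar>u\<bar> \<le> K' \<Longrightarrow> x u = z" "(c ^^ t) x 0 \<noteq> z"
    using assms nilpotent_if_blank_protected[of K'] by blast
  have "r * int t > r * int N" using arrival_time[OF x] by (simp add: K'_def)
  then have tN: "N \<le> t" using r_nonneg by (smt (verit) mult_left_mono of_nat_le_iff nat_le_linear)
  obtain y where y: "y \<in> X" "\<And>u. \<bar>u\<bar> \<le> K' + r * int t \<Longrightarrow> y u = x u" "(c ^^ N) y \<in> homoclinic"
    using N[OF x(1)] by blast
  have rt: "0 \<le> r * int t" "0 \<le> r * int N" using r_nonneg by auto
  have "(c ^^ N) y u = z" if "\<bar>u\<bar> \<le> K" for u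
    by (rule light_cone_blank[OF y(1)]) (use that y(2) x(2) rt in \<open>auto simp: K'_def\<close>)
  moreover have "(c ^^ (t - N)) ((c ^^ N) y) 0 = (c ^^ t) y 0"
    using tN by (simp flip: iter_add)
  moreover have "(c ^^ t) y 0 = (c ^^ t) x 0"
    by (rule light_cone[OF y(1) x(1)]) (use y(2) rt in \<open>auto simp: K'_def\<close>)
  ultimately show ?thesis using y(3) x(3) by metis
qed

section \<open>Accumulating visits\<close>

text \<open>
  The diagonal construction, in the manner of the Baire category theorem. If visits near the origin could always be added
  by changing a point of \<open>P\<close> far away only, the changes would converge to a point
  with infinitely many visits. The limit lies in \<open>X\<close> but need not lie in \<open>P\<close>,
  so the lemma applies to classes that are not closed, such as homoclinic points.
\<close>

lemma no_recurrent_visits: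
  assumes "P \<subseteq> X" "P \<noteq> {}"
    and step: "\<And>x R N. x \<in> P \<Longrightarrow> \<exists>y\<in>P. (\<forall>u. \<bar>u\<bar> \<le> R \<longrightarrow> y u = x u) \<and>
      (\<exists>t\<ge>N. \<exists>j. \<bar>j\<bar> \<le> r \<and> (c ^^ t) y j \<noteq> z)"
  shows False
proof -
  \<comment> \<open>The cells that stage \<open>k\<close> fixes forever: the light cone of the visit at time \<open>t\<close> to
    the cells in \<open>[-r, r]\<close>, and \<open>k\<close> more so that every cell is fixed at some stage.\<close>
  define R where "R = (\<lambda>k t. int k + r + r * int t)"
  obtain x0 where x0: "x0 \<in> P" using assms(2) by blast
  have "\<exists>f. \<forall>k. fst (f k) \<in> P \<and>
      ((\<forall>u. \<bar>u\<bar> \<le> R k (snd (f k)) \<longrightarrow> fst (f (Suc k)) u = fst (f k) u) \<and>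
       snd (f (Suc k)) > snd (f k) \<and>
       (\<exists>j. \<bar>j\<bar> \<le> r \<and> (c ^^ snd (f (Suc k))) (fst (f (Suc k))) j \<noteq> z))"
  proof (rule dependent_nat_choice)
    show "\<exists>s :: (int \<Rightarrow> 'a) \<times> nat. fst s \<in> P" using x0 by (intro exI[of _ "(x0, 0)"]) auto
  next
    fix s :: "(int \<Rightarrow> 'a) \<times> nat" and k
    assume "fst s \<in> P"
    then obtain y t where "y \<in> P" "\<forall>u. \<bar>u\<bar> \<le> R k (snd s) \<longrightarrow> y u = fst s u"
      "t \<ge> Suc (snd s)" "\<exists>j. \<bar>j\<bar> \<le> r \<and> (c ^^ t) y j \<noteq> z"
      using step[of "fst s" "R k (snd s)" "Suc (snd s)"] by blast
    then show "\<exists>s'. fst s' \<in> P \<and> (\<forall>u. \<bar>u\<bar> \<le> R k (snd s) \<longrightarrow> fst s' u = fst s u) \<and>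
        snd s < snd s' \<and> (\<exists>j. \<bar>j\<bar> \<le> r \<and> (c ^^ snd s') (fst s') j \<noteq> z)"
      by (intro exI[of _ "(y, t)"]) auto
  qed
  then obtain f where f: "\<And>k. fst (f k) \<in> P"
      "\<And>k u. \<bar>u\<bar> \<le> R k (snd (f k)) \<Longrightarrow> fst (f (Suc k)) u = fst (f k) u"
      "\<And>k. snd (f (Suc k)) > snd (f k)"
      "\<And>k. \<exists>j. \<bar>j\<bar> \<le> r \<and> (c ^^ snd (f (Suc k))) (fst (f (Suc k))) j \<noteq> z"
    by blast
  define x where "x = (\<lambda>k. fst (f k))"
  define t where "t = (\<lambda>k. snd (f k))"
  have xP: "x k \<in> X" for k using f(1) assms(1) by (auto simp: x_def)
  have tmono: "strict_mono t" unfolding strict_mono_Suc_iff using f(3) by (simp add: t_def)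
  have Rmono: "R k (t k) \<le> R l (t l)" if "k \<le> l" for k l
    using that strict_mono_less_eq[OF tmono] r_nonneg
    by (auto simp: R_def intro!: add_mono mult_left_mono)
  have later: "x l u = x k u" if "\<bar>u\<bar> \<le> R k (t k)" "k \<le> l" for k l u
    using that(2)
  proof (induction l rule: dec_induct)
    case (step l)
    have "\<bar>u\<bar> \<le> R l (t l)" using Rmono[OF step(1)] that(1) by simp
    then have "x (Suc l) u = x l u" using f(2) by (simp add: x_def t_def)
    with step show ?case by simp
  qed simp
  define y where "y = (\<lambda>u. x (nat \<bar>u\<bar>) u)"
  have yx: "y u = x k u" if "\<bar>u\<bar> \<le> R k (t k)" for u k
  proof (cases "k \<le> nat \<bar>u\<bar>")
    case True
    then show ?thesis using later[OF that True] by (simp add: y_def)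
  next
    case False
    have "\<bar>u\<bar> \<le> R (nat \<bar>u\<bar>) (t (nat \<bar>u\<bar>))" using r_nonneg by (simp add: R_def)
    then show ?thesis using later[of u "nat \<bar>u\<bar>" k] False by (simp add: y_def)
  qed
  have yX: "y \<in> X"
  proof (rule memI)
    fix v
    define k where "k = nat (\<bar>v\<bar> + m)"
    have "y u = x k u" if "u \<in> {v..<v + m}" for u
    proof (rule yx)
      have "\<bar>u\<bar> \<le> int k" using that by (auto simp: k_def)
      also have "\<dots> \<le> R k (t k)" using r_nonneg by (simp add: R_def)
      finally show "\<bar>u\<bar> \<le> R k (t k)" .
    qed
    then show "\<exists>w\<in>X. \<forall>u\<in>{v..<v + m}. y u = w u" using xP by blast
  qed
  then obtain N where N: "\<And>n j. n \<ge> N \<Longrightarrow> \<bar>j\<bar> \<le> r \<Longrightarrow> (c ^^ n) y j = z"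
    using vanishing_on_ball[OF yX] by blast
  obtain j where j: "\<bar>j\<bar> \<le> r" "(c ^^ t (Suc N)) (x (Suc N)) j \<noteq> z"
    using f(4) by (auto simp: t_def x_def)
  have "(c ^^ t (Suc N)) y j = (c ^^ t (Suc N)) (x (Suc N)) j"
    by (rule light_cone[OF yX xP], rule yx) (use j(1) in \<open>auto simp: R_def\<close>)
  moreover have "t (Suc N) \<ge> N"
    using strict_mono_imp_increasing[OF tmono, of "Suc N"] by simp
  ultimately show False using N j by auto
qed

lemma blank_homoclinic: "blank \<in> homoclinic"
  by (simp add: homoclinic_def blank_mem)

section \<open>Blockers and their trains\<close>

text \<open>
  Homoclinic points cannot accumulate visits, so at one of them the construction gets stuck. From
  time \<open>N\<close> on, the cells \<open>[-r, r]\<close> then form a wall of zeros whatever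
  homoclinic surroundings are chosen, and it is too wide for the automaton to look across in one step.
\<close>

lemma blocker:
  obtains b R N where "b \<in> homoclinic" "R \<ge> 0"
    "\<And>y t j. y \<in> homoclinic \<Longrightarrow> (\<And>u. \<bar>u\<bar> \<le> R \<Longrightarrow> y u = b u) \<Longrightarrow> t \<ge> N \<Longrightarrow> \<bar>j\<bar> \<le> r \<Longrightarrow> (c ^^ t) y j = z"
proof -
  have "homoclinic \<subseteq> X" "homoclinic \<noteq> {}"
    using blank_homoclinic by (auto simp: homoclinic_def)
  then obtain b R N where b: "b \<in> homoclinic"
    "\<And>y t j. y \<in> homoclinic \<Longrightarrow> (\<And>u. \<bar>u\<bar> \<le> R \<Longrightarrow> y u = b u) \<Longrightarrow> t \<ge> N \<Longrightarrow> \<bar>j\<bar> \<le> r \<Longrightarrow> (c ^^ t) y j = z"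
    using no_recurrent_visits[of homoclinic] by metis
  show ?thesis
    by (rule that[of b "max 0 R" N]) (use b in auto)
qed

text \<open>
  Two evolutions that agree on a region at time \<open>N\<close>, and on the walls \<open>C\<close> at all
  later times, agree on the region forever: a cell of the region that is not in a wall sees only
  cells of the region.
\<close>

lemma barrier:
  assumes "x \<in> X" "y \<in> X"
    and side: "\<And>u v. u \<in> W \<Longrightarrow> \<bar>v - u\<bar> \<le> r \<Longrightarrow> u \<in> C \<or> v \<in> W"
    and wall: "\<And>t u. t \<ge> N \<Longrightarrow> u \<in> C \<Longrightarrow> (c ^^ t) x u = (c ^^ t) y u"
    and start: "\<And>u. u \<in> W \<Longrightarrow> (c ^^ N) x u = (c ^^ N) y u"
    and "t \<ge> N" "u \<in> W"
  shows "(c ^^ t) x u = (c ^^ t) y u"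
  using \<open>t \<ge> N\<close> \<open>u \<in> W\<close>
proof (induction t arbitrary: u rule: dec_induct)
  case base
  then show ?case by (rule start)
next
  case (step t)
  show ?case
  proof (cases "u \<in> C")
    case True
    then show ?thesis using wall step by (meson le_SucI)
  next
    case False
    have "c ((c ^^ t) x) u = c ((c ^^ t) y) u"
      by (rule radius) (use assms(1,2) iter_mem side False step in blast)+
    then show ?thesis by simp
  qed
qed

text \<open>
  The property of a blocker passes to limits of homoclinic points, since each cell at each time
  depends on finitely many cells. This is needed because trains of blockers are not homoclinic.
\<close>

definition homoclinic_limit :: "(int \<Rightarrow> 'a) \<Rightarrow> bool" where
  "homoclinic_limit y \<longleftrightarrow> y \<in> X \<and> (\<forall>M. \<exists>h\<in>homoclinic. \<forall>u. \<bar>u\<bar> \<le> M \<longrightarrow> h u = y u)"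

lemma homoclinic_shift:
  assumes "x \<in> homoclinic"
  shows "shift v x \<in> homoclinic"
proof -
  obtain B where B: "x \<in> X" "\<And>u. \<bar>u\<bar> > B \<Longrightarrow> x u = z" using assms by (auto simp: homoclinic_def)
  have "\<forall>u. \<bar>u\<bar> > B + \<bar>v\<bar> \<longrightarrow> shift v x u = z" using B(2) by (auto simp: shift_def)
  then show ?thesis using shift_mem B(1) by (auto simp: homoclinic_def)
qed

lemma homoclinic_limitI:
  assumes y: "y \<in> X"
    and cuts: "\<And>M. \<exists>a\<ge>M. (\<forall>u. a \<le> u \<and> u < a + m \<longrightarrow> y u = z) \<and> (\<forall>u. - a - m \<le> u \<and> u < - a \<longrightarrow> y u = z)"
  shows "homoclinic_limit y"
  unfolding homoclinic_limit_def
proof (intro conjI allI y)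
  fix M
  obtain a where a: "a \<ge> \<bar>M\<bar> + 1" "\<forall>u. a \<le> u \<and> u < a + m \<longrightarrow> y u = z"
    "\<forall>u. - a - m \<le> u \<and> u < - a \<longrightarrow> y u = z"
    using cuts by blast
  let ?h = "\<lambda>u. if - a \<le> u \<and> u < a then y u else blank u"
  have "?h \<in> X" by (rule insert_block) (use y blank_mem a in auto)
  moreover have "\<forall>u. \<bar>u\<bar> > a \<longrightarrow> ?h u = z" by auto
  ultimately have "?h \<in> homoclinic" unfolding homoclinic_def by blast
  then show "\<exists>h\<in>homoclinic. \<forall>u. \<bar>u\<bar> \<le> M \<longrightarrow> h u = y u"
    by (rule bexI[rotated]) (use a(1) in auto)
qed

lemma block_in_limit:
  assumes block: "\<And>y t j. y \<in> homoclinic \<Longrightarrow> (\<And>u. \<bar>u\<bar> \<le> R \<Longrightarrow> y u = b u) \<Longrightarrow> t \<ge> N \<Longrightarrow> \<bar>j\<bar> \<le> r \<Longrightarrow> (c ^^ t) y j = z"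
    and y: "homoclinic_limit y" "\<And>u. \<bar>u\<bar> \<le> R \<Longrightarrow> y (u + s) = b u"
    and t: "t \<ge> N" and j: "\<bar>j - s\<bar> \<le> r"
  shows "(c ^^ t) y j = z"
proof -
  define M where "M = \<bar>s\<bar> + \<bar>R\<bar> + r + r * int t"
  have rt: "r * int t \<ge> 0" using r_nonneg by simp
  obtain h where h: "h \<in> homoclinic" "\<And>u. \<bar>u\<bar> \<le> M \<Longrightarrow> h u = y u"
    using y(1) by (auto simp: homoclinic_limit_def)
  have X: "y \<in> X" "h \<in> X" using y(1) h(1) by (auto simp: homoclinic_limit_def homoclinic_def)
  have "(c ^^ t) y j = (c ^^ t) h j"
    by (rule light_cone[OF X]) (use h(2) j in \<open>auto simp: M_def\<close>)
  also have "\<dots> = (c ^^ t) (shift s h) (j - s)"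
    using iter_shift[OF X(2)] by (simp add: shift_def)
  also have "\<dots> = z"
  proof (rule block[OF homoclinic_shift[OF h(1)] _ t j])
    fix u assume u: "\<bar>u\<bar> \<le> R"
    have "\<bar>u + s\<bar> \<le> M" using u rt r_nonneg unfolding M_def by linarith
    then show "shift s h u = b u" using h(2) y(2)[OF u] by (simp add: shift_def)
  qed
  finally show ?thesis .
qed

text \<open>
  The point \<open>b\<close> repeated with period \<open>2 * B + 1\<close>, the \<open>k\<close>-th copy being centred at
  \<open>k * (2 * B + 1)\<close>. The zeros around the border between neighbouring copies, where one copy
  ends at offset \<open>B\<close> from its centre, are the places where the train can be cut. The bound \<open>E\<close> forces the
  copies as far apart as an application needs.
\<close>

lemma blocker_train:
  fixes E :: int
  assumes b: "b \<in> homoclinic"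
  shows "\<exists>p B. B > E \<and> B > 0 \<and> p \<in> X \<and> p \<in> periodic_points (2 * B + 1) \<and>
    (\<forall>k u. \<bar>u\<bar> \<le> B \<longrightarrow> p (u + k * (2 * B + 1)) = b u) \<and>
    (\<forall>k u. \<bar>u\<bar> \<le> m + 1 \<longrightarrow> p (u + k * (2 * B + 1) + B) = z)"
proof -
  obtain B0 where B0: "\<And>u. \<bar>u\<bar> > B0 \<Longrightarrow> b u = z" and bX: "b \<in> X"
    using b by (auto simp: homoclinic_def)
  define B where "B = \<bar>B0\<bar> + \<bar>E\<bar> + 2 * m + 4"
  define L where "L = 2 * B + 1"
  have L: "L > 0" and B: "B > E" "B > 0" using m_pos by (auto simp: B_def L_def)
  define p where "p = (\<lambda>u. b ((u + B) mod L - B))"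
  have on: "p (u + k * L) = b u" if "\<bar>u\<bar> \<le> B" for u k
  proof -
    have "(u + k * L + B) mod L = (u + B + k * L) mod L" by (simp add: algebra_simps)
    also have "\<dots> = (u + B) mod L" by (rule mod_mult_self1)
    also have "\<dots> = u + B" using that by (intro mod_pos_pos_trivial) (auto simp: L_def)
    finally show ?thesis by (simp add: p_def)
  qed
  have off: "p (u + k * L + B) = z" if u: "\<bar>u\<bar> \<le> m + 1" for u k
  proof (cases "u \<le> 0")
    case True
    have "p (u + k * L + B) = p ((u + B) + k * L)" by (simp add: algebra_simps)
    also have "\<dots> = b (u + B)" by (rule on) (use True u in \<open>auto simp: B_def\<close>)
    also have "\<dots> = z" by (rule B0) (use u m_pos in \<open>auto simp: B_def\<close>)
    finally show ?thesis .
  next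
    case False
    have "p (u + k * L + B) = p ((u - B - 1) + (k + 1) * L)" by (simp add: algebra_simps L_def)
    also have "\<dots> = b (u - B - 1)" by (rule on) (use False u in \<open>auto simp: B_def\<close>)
    also have "\<dots> = z" by (rule B0) (use u m_pos in \<open>auto simp: B_def\<close>)
    finally show ?thesis .
  qed
  have pX: "p \<in> X"
  proof (rule memI)
    fix v
    define k where "k = (v + B) div L"
    have "v + B = k * L + (v + B) mod L" by (simp add: k_def)
    moreover have "0 \<le> (v + B) mod L" "(v + B) mod L < L" using L by auto
    ultimately have v: "k * L - B \<le> v" "v \<le> k * L + B" by (auto simp: L_def)
    have "p u = shift (- k * L) b u" if u: "u \<in> {v..<v + m}" for u
    proof (cases "u \<le> k * L + B")
      case True
      have "p ((u - k * L) + k * L) = b (u - k * L)" by (rule on) (use u v True in auto)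
      then show ?thesis by (simp add: shift_def)
    next
      case False
      have "p ((u - k * L - B) + k * L + B) = z" by (rule off) (use u v False in auto)
      moreover have "b (u - k * L) = z" by (rule B0) (use u v False m_pos in \<open>auto simp: B_def\<close>)
      ultimately show ?thesis by (simp add: shift_def)
    qed
    then show "\<exists>y\<in>X. \<forall>u\<in>{v..<v + m}. p u = y u" using shift_mem[OF bX] by blast
  qed
  moreover have "p (u + L) = p u" for u
  proof -
    have "(u + L + B) mod L = (u + B + L) mod L" by (simp add: algebra_simps)
    then show ?thesis by (simp add: p_def)
  qed
  ultimately have "p \<in> periodic_points L"
    using L by (auto simp: periodic_points_def intro!: bexI[of _ L])
  then show ?thesis using B pX on off by (intro exI[of _ p] exI[of _ B]) (simp add: L_def)
qed

section \<open>Mortal visitors\<close>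

definition mortal :: "(int \<Rightarrow> 'a) set" where
  "mortal = {x \<in> homoclinic. \<exists>D. (c ^^ D) x = blank}"

text \<open>
  A homoclinic visitor is placed between two half-infinite trains of blockers. Beyond the innermost
  blockers the evolution is that of the complete train, hence zero after a time \<open>N\<close> that is fixed
  before the visitor is chosen; between them only finitely many cells remain, and these die.
  The mortal visitor is the iterate at time \<open>N\<close>, which is homoclinic although the
  initial point is not; the block of zeros of the original visitor is chosen so long that its visit
  comes after \<open>N\<close>.
\<close>

lemma mortal_visitor:
  assumes "\<not> nilpotent z X c"
  shows "\<exists>x\<in>mortal. (\<forall>u. \<bar>u\<bar> \<le> K \<longrightarrow> x u = z) \<and> (\<exists>t. (c ^^ t) x 0 \<noteq> z)"
proof -
  obtain b R N0 where b: "b \<in> homoclinic" "R \<ge> 0"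
    and block: "\<And>y t j. y \<in> homoclinic \<Longrightarrow> (\<And>u. \<bar>u\<bar> \<le> R \<Longrightarrow> y u = b u) \<Longrightarrow> t \<ge> N0 \<Longrightarrow> \<bar>j\<bar> \<le> r \<Longrightarrow> (c ^^ t) y j = z"
    using blocker by metis
  obtain p B where B: "B > R + r * int N0 + r" "B > 0" and p: "p \<in> X" "p \<in> periodic_points (2 * B + 1)"
    and on: "\<And>k u. \<bar>u\<bar> \<le> B \<Longrightarrow> p (u + k * (2 * B + 1)) = b u"
    and off: "\<And>k u. \<bar>u\<bar> \<le> m + 1 \<Longrightarrow> p (u + k * (2 * B + 1) + B) = z"
    using blocker_train[OF b(1), of "R + r * int N0 + r"] by blast
  define L where "L = 2 * B + 1"
  note on = on[folded L_def] and off = off[folded L_def]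
  obtain Np where Np: "\<And>n. n \<ge> Np \<Longrightarrow> (c ^^ n) p = blank"
    using periodic_dies[OF p(2)] by blast
  define N where "N = max N0 Np"
  define K' where "K' = \<bar>K\<bar> + r * int N"
  obtain x t where x: "x \<in> homoclinic" "\<And>u. \<bar>u\<bar> \<le> K' \<Longrightarrow> x u = z" "(c ^^ t) x 0 \<noteq> z"
    using homoclinic_visitor[OF assms] by blast
  have xX: "x \<in> X" using x(1) by (simp add: homoclinic_def)
  obtain D where D: "\<And>u. \<bar>u\<bar> > D \<Longrightarrow> x u = z" using x(1) by (auto simp: homoclinic_def)
  have rt: "0 \<le> r * int t" "0 \<le> r * int N" "0 \<le> r * int N0" using r_nonneg by auto
  have "r * int t > r * int N" using arrival_time[OF xX x(2,3)] by (simp add: K'_def)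
  then have tN: "N \<le> t" using r_nonneg by (smt (verit) mult_left_mono of_nat_le_iff nat_le_linear)
  \<comment> \<open>The innermost blockers are centred at \<open>A\<close> and \<open>-A\<close>, so far out that neither the support of
    \<open>x\<close> nor the light cone of its visit at time \<open>t\<close> reaches the cut at distance \<open>a\<close>.\<close>
  define k where "k = \<bar>D\<bar> + K' + r * int t + 2"
  define A where "A = k * L"
  define a where "a = A - B"
  have k: "k \<ge> 1" using rt by (auto simp: k_def K'_def)
  have "A \<ge> k + 2 * B"
  proof -
    have "k * B \<ge> 1 * B" using k B(2) by (intro mult_right_mono) auto
    then show ?thesis by (simp add: A_def L_def algebra_simps)
  qed
  then have a: "a > 0" "a > D" "a > K' + r * int t"
    using rt B(2) by (auto simp: a_def k_def K'_def)
  define y where "y = (\<lambda>u. if - a \<le> u \<and> u < a then x u else p u)"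
  have yX: "y \<in> X" unfolding y_def
  proof (rule insert_block[OF xX p(1)])
    fix u assume u: "a \<le> u" "u < a + m"
    have "p ((u - a + 1) + (k - 1) * L + B) = z" by (rule off) (use u in auto)
    moreover have "(u - a + 1) + (k - 1) * L + B = u" by (simp add: a_def A_def L_def algebra_simps)
    ultimately show "x u = p u" using D[of u] u a by simp
  next
    fix u assume u: "- a - m \<le> u" "u < - a"
    have "p ((u + a) + (- k) * L + B) = z" by (rule off) (use u in auto)
    then show "x u = p u" using D[of u] u a by (simp add: a_def A_def)
  qed (use a in simp)
  have yp: "y u = p u" if "u \<ge> a \<or> u < - a" for u using that a(1) by (auto simp: y_def)
  have lim: "homoclinic_limit w" if w: "w \<in> X" "\<And>u. u \<ge> a \<or> u < - a \<Longrightarrow> w u = p u" for w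
  proof (rule homoclinic_limitI[OF w(1)])
    fix M
    define l where "l = \<bar>M\<bar> + \<bar>a\<bar> + 1"
    define d where "d = l * L + B"
    have "l * L \<ge> l"
      using mult_left_mono[of 1 L l] B(2) by (simp add: l_def L_def)
    then have d: "d \<ge> M" and "d > a"
      using B(2) l_def unfolding d_def by linarith+
    have "w u = z" if "d \<le> u" "u < d + m" for u
    proof -
      have "p ((u - d) + l * L + B) = z" by (rule off) (use that in auto)
      then show ?thesis using w(2)[of u] that \<open>d > a\<close> by (simp add: d_def)
    qed
    moreover have "w u = z" if "- d - m \<le> u" "u < - d" for u
    proof -
      have "p ((u + d + 1) + (- l - 1) * L + B) = z" by (rule off) (use that in auto)
      moreover have "(u + d + 1) + (- l - 1) * L + B = u" by (simp add: d_def L_def algebra_simps)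
      ultimately show ?thesis using w(2)[of u] that \<open>d > a\<close> by simp
    qed
    ultimately show "\<exists>a\<ge>M. (\<forall>u. a \<le> u \<and> u < a + m \<longrightarrow> w u = z) \<and> (\<forall>u. - a - m \<le> u \<and> u < - a \<longrightarrow> w u = z)"
      using d(1) by blast
  qed
  have BR: "B > R" using B(1) rt r_nonneg by linarith
  have wall: "(c ^^ n) w u = z" if w: "w \<in> X" "\<And>u. u \<ge> a \<or> u < - a \<Longrightarrow> w u = p u"
    and n: "n \<ge> N0" and u: "\<bar>u - A\<bar> \<le> r \<or> \<bar>u + A\<bar> \<le> r" for w n u
    using u
  proof
    assume "\<bar>u - A\<bar> \<le> r"
    moreover have "w (v + A) = b v" if "\<bar>v\<bar> \<le> R" for v
    proof -
      have "v + A \<ge> a" using that BR unfolding a_def by linarith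
      then show ?thesis using w(2) on[of v k] that BR by (simp add: A_def)
    qed
    ultimately show ?thesis by (intro block_in_limit[OF block lim[OF w] _ n])
  next
    assume "\<bar>u + A\<bar> \<le> r"
    then have "\<bar>u - (- A)\<bar> \<le> r" by simp
    moreover have "w (v + - A) = b v" if "\<bar>v\<bar> \<le> R" for v
    proof -
      have "v + - A < - a" using that BR unfolding a_def by linarith
      then show ?thesis using w(2) on[of v "- k"] that BR by (simp add: A_def)
    qed
    ultimately show ?thesis by (intro block_in_limit[OF block lim[OF w] _ n])
  qed
  \<comment> \<open>At time \<open>N0\<close>, when the walls around \<open>A\<close> and \<open>-A\<close> come into force, the cut has not yet
    been felt there, because \<open>B\<close> exceeds \<open>r * N0\<close>.\<close>
  have outside: "(c ^^ n) y u = (c ^^ n) p u" if n: "n \<ge> N0" and u: "u \<in> {A..} \<union> {..- A}" for n u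
  proof (rule barrier[OF yX p(1) _ _ _ n u])
    show "v \<in> {A - r..A + r} \<union> {- A - r..- A + r} \<or> w \<in> {A..} \<union> {..- A}"
      if "v \<in> {A..} \<union> {..- A}" "\<bar>w - v\<bar> \<le> r" for v w using that by auto
    show "(c ^^ n) y v = (c ^^ n) p v" if "n \<ge> N0" "v \<in> {A - r..A + r} \<union> {- A - r..- A + r}" for n v
      using wall[OF yX yp that(1)] wall[OF p(1) refl that(1)] that(2) by (auto simp: abs_le_iff)
    show "(c ^^ N0) y v = (c ^^ N0) p v" if "v \<in> {A..} \<union> {..- A}" for v
      by (rule light_cone[OF yX p(1)], rule yp) (use that B b(2) r_nonneg in \<open>auto simp: a_def\<close>)
  qed
  have quiet: "(c ^^ n) y u = z" if "n \<ge> N" "\<bar>u\<bar> \<ge> A" for n u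
  proof -
    have "u \<in> {A..} \<union> {..- A}" using that(2) by (cases "u \<ge> 0") auto
    then show ?thesis using outside[of n u] Np[of n] that(1) by (simp add: N_def)
  qed
  have yN: "(c ^^ N) y \<in> homoclinic"
    using iter_mem[OF yX] quiet by (auto simp: homoclinic_def intro!: exI[of _ A])
  obtain T where T: "\<And>n u. n \<ge> T \<Longrightarrow> \<bar>u\<bar> \<le> A \<Longrightarrow> (c ^^ n) y u = z"
    using vanishing_on_ball[OF yX] by blast
  have "(c ^^ (T + N)) y u = z" for u
    using T[of "T + N" u] quiet[of "T + N" u] by (cases "\<bar>u\<bar> \<ge> A") auto
  then have "(c ^^ T) ((c ^^ N) y) = blank" by (auto simp flip: iter_add)
  then have "(c ^^ N) y \<in> mortal" using yN by (auto simp: mortal_def)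
  moreover have "(c ^^ N) y u = z" if "\<bar>u\<bar> \<le> K" for u
    by (rule light_cone_blank[OF yX]) (use that x(2) a rt in \<open>auto simp: y_def K'_def\<close>)
  moreover have "(c ^^ (t - N)) ((c ^^ N) y) 0 = (c ^^ t) y 0"
    using tN by (simp flip: iter_add)
  moreover have "(c ^^ t) y 0 = (c ^^ t) x 0"
    by (rule light_cone[OF yX xX]) (use a rt in \<open>auto simp: y_def K'_def\<close>)
  ultimately show ?thesis using x(3) by metis
qed

text \<open>
  Mortal points accumulate visits. Given a mortal point \<open>x\<close> that dies by time \<open>D\<close>, a
  mortal visitor \<open>y\<close> is put around it whose central block of zeros is too wide for the two to
  meet before time \<open>D\<close>; by then \<open>x\<close> has disappeared, and \<open>y\<close> is yet to arrive.
\<close>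

theorem is_nilpotent: "nilpotent z X c"
proof (rule ccontr)
  assume nn: "\<not> nilpotent z X c"
  show False
  proof (rule no_recurrent_visits[of mortal])
    show "mortal \<subseteq> X" by (auto simp: mortal_def homoclinic_def)
    show "mortal \<noteq> {}" using mortal_visitor[OF nn] by blast
  next
    fix x R N
    assume "x \<in> mortal"
    then obtain B D where x: "x \<in> X" "\<And>u. \<bar>u\<bar> > B \<Longrightarrow> x u = z" "(c ^^ D) x = blank"
      by (auto simp: mortal_def homoclinic_def)
    define T where "T = max N D"
    define a where "a = \<bar>R\<bar> + \<bar>B\<bar> + 1"
    define K where "K = a + m + 2 * r * int T"
    obtain y t where y: "y \<in> mortal" "\<And>u. \<bar>u\<bar> \<le> K \<Longrightarrow> y u = z" "(c ^^ t) y 0 \<noteq> z"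
      using mortal_visitor[OF nn] by blast
    have yX: "y \<in> X" using y(1) by (auto simp: mortal_def homoclinic_def)
    have rT: "r * int T \<ge> 0" "r * int D \<ge> 0" "r * int D \<le> r * int T"
      using r_nonneg by (auto simp: T_def intro: mult_left_mono)
    have "r * int t > r * int T" using arrival_time[OF yX y(2,3)] rT m_pos by (auto simp: K_def a_def)
    then have tT: "T \<le> t" using r_nonneg by (smt (verit) mult_left_mono of_nat_le_iff nat_le_linear)
    define w where "w = (\<lambda>u. if - a \<le> u \<and> u < a then x u else y u)"
    have wX: "w \<in> X" unfolding w_def
      by (rule insert_block) (use x y(2) yX rT in \<open>auto simp: a_def K_def\<close>)
    have "(c ^^ D) w u = (c ^^ D) y u" for u
    proof (cases "\<bar>u\<bar> \<le> a + r * int D")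
      case True
      have "(c ^^ D) w u = (c ^^ D) x u"
        by (rule light_cone[OF wX x(1)])
          (use True x(2) y(2) rT m_pos in \<open>auto simp: w_def a_def K_def\<close>)
      moreover have "(c ^^ D) y u = z"
        by (rule light_cone_blank[OF yX]) (use True y(2) rT m_pos in \<open>auto simp: K_def\<close>)
      ultimately show ?thesis using x(3) by simp
    next
      case False
      show ?thesis
        by (rule light_cone[OF wX yX]) (use False in \<open>auto simp: w_def\<close>)
    qed
    then have D: "(c ^^ D) w = (c ^^ D) y" by blast
    have later: "(c ^^ n) w = (c ^^ n) y" if "n \<ge> D" for n
      using iter_add[of "n - D" D] D that by simp
    obtain B' D' where y': "\<And>u. \<bar>u\<bar> > B' \<Longrightarrow> y u = z" "(c ^^ D') y = blank"
      using y(1) by (auto simp: mortal_def homoclinic_def)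
    have "(c ^^ (D + D')) w = blank"
      using later[of "D + D'"] iter_add[of D D' y] y'(2) iter_blank by simp
    moreover have "\<forall>u. \<bar>u\<bar> > max a B' \<longrightarrow> w u = z" using y'(1) by (auto simp: w_def)
    ultimately have "w \<in> mortal" using wX unfolding mortal_def homoclinic_def by blast
    moreover have "\<forall>u. \<bar>u\<bar> \<le> R \<longrightarrow> w u = x u" by (auto simp: w_def a_def)
    moreover have "(c ^^ t) w 0 \<noteq> z" "t \<ge> N" using later[of t] tT y(3) by (auto simp: T_def)
    ultimately show "\<exists>y\<in>mortal. (\<forall>u. \<bar>u\<bar> \<le> R \<longrightarrow> y u = x u) \<and>
        (\<exists>t\<ge>N. \<exists>j. \<bar>j\<bar> \<le> r \<and> (c ^^ t) y j \<noteq> z)"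
      using r_nonneg by (metis abs_zero)
  qed
qed

end

theorem corollary1:
  fixes S :: "'a set" and z :: 'a
    and X :: "(int \<Rightarrow> 'a) set" and c :: "(int \<Rightarrow> 'a) \<Rightarrow> (int \<Rightarrow> 'a)"
  assumes "finite S" and "z \<in> S"
    and "subshift_of_finite_type S X"
    and "cellular_automaton S X c"
    and "asymptotically_nilpotent z X c"
  shows "nilpotent z X c"
proof (cases "X = {}")
  case True
  then show ?thesis by (simp add: nilpotent_def)
next
  case False
  have sub: "subshift S X" using assms(3) by (simp add: subshift_of_finite_type_def)
  then have cl: "closedin (full_shift_topology S) X" and inv: "\<And>v. shift v ` X = X"
    by (auto simp: subshift_def)
  have XS: "X \<subseteq> full_shift S" using closedin_subset[OF cl] by simp
  obtain m where m: "m > 0" "\<And>x. \<forall>v. \<exists>y\<in>X. \<forall>u\<in>{v..<v + m}. x u = y u \<Longrightarrow> x \<in> X"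
    using finite_type_has_window[OF assms(3)] by blast
  obtain r where r: "r \<ge> 0" "\<And>x y i. x \<in> X \<Longrightarrow> y \<in> X \<Longrightarrow> \<forall>u. \<bar>u - i\<bar> \<le> r \<longrightarrow> x u = y u \<Longrightarrow> c x i = c y i"
    using cellular_automaton_has_radius[OF assms(1) sub assms(4)] by blast
  interpret asymptotically_nilpotent_automaton S z X c m r
  proof
    show "c x \<in> X" if "x \<in> X" for x
      using assms(4) that XS continuous_map_funspace by (fastforce simp: cellular_automaton_def)
    show "c (shift v x) = shift v (c x)" if "x \<in> X" for v x
      using assms(4) that by (simp add: cellular_automaton_def)
    show "\<exists>N. \<forall>n\<ge>N. (c ^^ n) x u = z" if "x \<in> X" for x u
      using assms(5) that by (simp add: asymptotically_nilpotent_def)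
    show "c x i = c y i" if "x \<in> X" "y \<in> X" "\<And>u. \<bar>u - i\<bar> \<le> r \<Longrightarrow> x u = y u" for x y i
      using r(2) that by blast
    show "x \<in> X" if "\<And>v. \<exists>y\<in>X. \<forall>u\<in>{v..<v + m}. x u = y u" for x
      using m(2) that by blast
    show "x u \<in> S" if "x \<in> X" for x u
      using that XS by (auto simp: full_shift_def)
    show "shift v x \<in> X" if "x \<in> X" for v x
      using that inv by blast
    show "\<exists>F\<subseteq>X. finite F \<and> (\<forall>y\<in>X. \<exists>x\<in>F. \<forall>u. \<bar>u\<bar> \<le> k x \<longrightarrow> y u = x u)" for k
      by (rule finite_cylinder_cover[OF assms(1) cl])
  qed (use assms(1) False m(1) r(1) in auto)
  show ?thesis by (rule is_nilpotent)
qed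

end
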